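(* Let $X\subset\mathbb{R}^d$ be a compact convex set, let $f:X\to\mathbb{R}$ be a Lipschitz convex function, and let $\epsilon>0$. Then there exists an input convex neural network with nonnegative weights and ReLU activation functions, taking the expanded input $\hat{\mathbf x}=\begin{bmatrix}\mathbf x\\-\mathbf x\end{bmatrix}$, whose output $\hat f(\mathbf x)$ satisfies $|f(\mathbf x)-\hat f(\mathbf x)|\le\epsilon$ for all $\mathbf x\in X$.
   Context: An input convex neural network (ICNN) with nonnegative weights and ReLU activations on $\mathbb{R}^d$ is a function $\mathbf x\mapsto \mathbf z_k\in\mathbb{R}$ of the form $$\mathbf z_1=\sigma_1(\mathbf W_1\hat{\mathbf x}+\mathbf b_1),\qquad \mathbf z_i=\sigma_i(\mathbf W_i\mathbf z_{i-1}+\mathbf D_i\hat{\mathbf x}+\mathbf b_i)\ (i=2,\dots,k),$$ where $\hat{\mathbf x}=\begin{bmatrix}\mathbf x\\-\mathbf x\end{bmatrix}\in\mathbb{R}^{2d}$, all entries of the weight matrices $\mathbf W_1,\dots,\mathbf W_k$ and of the passthrough weight matrices $\mathbf D_2,\dots,\mathbf D_k$ are nonnegative, the biases $\mathbf b_i$ are arbitrary real vectors, the hidden-layer activations $\sigma_1,\dots,\sigma_{k-1}$ are the componentwise ReLU $x\mapsto\max(x,0)$, and the output layer is linear ($\sigma_k$ is the identity). *)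

theory Defs
  imports "HOL-Analysis.Analysis"
begin

definition relu :: "real \<Rightarrow> real" where
  "relu t = max t 0"

(* The coordinates of R^(2d) are indexed by the type 'd + 'd: Inl i is the i-th coordinate of
   the upper block x, Inr i the i-th coordinate of the lower block -x. *)
definition expand :: "real ^ 'd \<Rightarrow> real ^ ('d + 'd)" where
  "expand x = (\<chi> j. case j of Inl i \<Rightarrow> x $ i | Inr i \<Rightarrow> - (x $ i))"

(* Depth and layer widths vary from network to network, so layers are indexed by 1..depth, the
   neurons of layer i by r < width i, and matrices and biases are given by their entries:
   W_first r j is the (r,j) entry of W_1, which acts on the expanded input;
   W i r s is the (r,s) entry of W_i, for 2 <= i, with s a neuron of layer i - 1;
   D i r j is the (r,j) entry of the passthrough matrix D_i, for 2 <= i;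
   bias i r is the r-th entry of b_i.
   Entries outside these ranges do not influence the output. *)
record 'd icnn =
  depth :: nat
  width :: "nat \<Rightarrow> nat"
  W_first :: "nat \<Rightarrow> 'd + 'd \<Rightarrow> real"
  W :: "nat \<Rightarrow> nat \<Rightarrow> nat \<Rightarrow> real"
  D :: "nat \<Rightarrow> nat \<Rightarrow> 'd + 'd \<Rightarrow> real"
  bias :: "nat \<Rightarrow> nat \<Rightarrow> real"

definition activation :: "'d icnn \<Rightarrow> nat \<Rightarrow> real \<Rightarrow> real" where
  "activation N i = (if i < depth N then relu else id)"

(* layer N x i r is the r-th entry of z_i; the value at i = 0 is a dummy that is never used. *)
fun layer :: "'d::finite icnn \<Rightarrow> real ^ 'd \<Rightarrow> nat \<Rightarrow> nat \<Rightarrow> real" where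
  "layer N x 0 r = 0"
| "layer N x (Suc 0) r =
     activation N 1 ((\<Sum>j\<in>UNIV. W_first N r j * expand x $ j) + bias N 1 r)"
| "layer N x (Suc (Suc i)) r =
     activation N (i + 2)
       ((\<Sum>s<width N (i + 1). W N (i + 2) r s * layer N x (Suc i) s)
        + (\<Sum>j\<in>UNIV. D N (i + 2) r j * expand x $ j)
        + bias N (i + 2) r)"

definition icnn_shape :: "'d icnn \<Rightarrow> bool" where
  "icnn_shape N \<longleftrightarrow>
     1 \<le> depth N \<and> (\<forall>i\<in>{1..depth N}. 1 \<le> width N i) \<and> width N (depth N) = 1"

definition nonneg_weights :: "'d icnn \<Rightarrow> bool" where
  "nonneg_weights N \<longleftrightarrow>
     (\<forall>r<width N 1. \<forall>j. 0 \<le> W_first N r j) \<and>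
     (\<forall>i\<in>{2..depth N}. \<forall>r<width N i. \<forall>s<width N (i - 1). 0 \<le> W N i r s) \<and>
     (\<forall>i\<in>{2..depth N}. \<forall>r<width N i. \<forall>j. 0 \<le> D N i r j)"

definition icnn_output :: "'d::finite icnn \<Rightarrow> real ^ 'd \<Rightarrow> real" where
  "icnn_output N x = layer N x (depth N) 0"

end

theory Submission
  imports Defs
begin

text \<open>
  A continuous convex function on a compact convex set is, up to \<open>\<epsilon>\<close>, a maximum of finitely many
  affine functions, and a maximum of finitely many affine functions is computed exactly by a network
  with one neuron per layer.

  For the first part, lower the graph of \<open>f\<close> by \<open>\<epsilon>\<close>: the point \<open>(y, f y - \<epsilon>)\<close> lies strictly below the
  closed convex epigraph, and a separating hyperplane is the graph of an affine minorant of \<open>f\<close> on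
  \<open>X\<close> which exceeds \<open>f - \<epsilon>\<close> at \<open>y\<close> (\<open>affine_minorant_near_point\<close>). Because of the slack \<open>\<epsilon>\<close> the
  hyperplane cannot be vertical, even when \<open>y\<close> is on the boundary of \<open>X\<close>. By continuity the
  minorant exceeds \<open>f - \<epsilon>\<close> near \<open>y\<close> as well, and compactness leaves finitely many minorants (\<open>finitely_many_affine_minorants\<close>).

  For the second part, let \<open>h\<^sub>0, \<dots>, h\<^sub>n\<close> be affine. The identity \<open>max u v = relu (u - v) + v\<close> shows that
  \<open>z\<^sub>i = max {h\<^sub>0, \<dots>, h\<^sub>i} - h\<^sub>i\<close> satisfies \<open>z\<^sub>i = relu (z\<^sub>i\<^sub>-\<^sub>1 + (h\<^sub>i\<^sub>-\<^sub>1 - h\<^sub>i))\<close>. Here the previous neuron enters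
  with weight 1, and the affine correction \<open>h\<^sub>i\<^sub>-\<^sub>1 - h\<^sub>i\<close>, whatever the signs of its coefficients, has
  nonnegative weights on the expanded input. The linear output layer adds back \<open>h\<^sub>n\<close>
  (\<open>max_affine_icnn\<close>).
\<close>

section \<open>Convex functions as maxima of affine functions\<close>

text \<open>
  This is a separating hyperplane for the epigraph and the point \<open>(y, f y - \<epsilon>)\<close>. Its normal \<open>(a, b)\<close>
  has \<open>b > 0\<close> because \<open>(y, f y)\<close> belongs to the epigraph and lies vertically above that
  point; division by \<open>b\<close> gives the minorant.
\<close>

lemma affine_minorant_near_point:
  fixes f :: "'a::euclidean_space \<Rightarrow> real"
  assumes "closed X" "convex_on X f" "continuous_on X f" "y \<in> X" "\<epsilon> > 0"
  obtains a c where "\<And>x. x \<in> X \<Longrightarrow> a \<bullet> x + c \<le> f x" "f y - \<epsilon> < a \<bullet> y + c"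
proof -
  have "closed (epigraph X f)"
  proof -
    have "continuous_on (X \<times> UNIV) (\<lambda>z :: 'a \<times> real. f (fst z) - snd z)"
      by (intro continuous_intros continuous_on_compose2[OF assms(3)]) auto
    moreover have "closed (X \<times> (UNIV :: real set))"
      using assms(1) by (simp add: closed_Times)
    ultimately have "closed ((X \<times> UNIV) \<inter> (\<lambda>z. f (fst z) - snd z) -` {..0})"
      by (rule continuous_closed_preimage) simp
    moreover have "epigraph X f = (X \<times> UNIV) \<inter> (\<lambda>z. f (fst z) - snd z) -` {..0}"
      by (auto simp: epigraph_def)
    ultimately show ?thesis by simp
  qed
  moreover have "convex (epigraph X f)"
    using assms(2) by (simp add: convex_epigraph)
  moreover have "(y, f y - \<epsilon>) \<notin> epigraph X f"
    using assms(5) by (simp add: epigraph_def)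
  ultimately obtain n c where below: "n \<bullet> (y, f y - \<epsilon>) < c"
    and above: "\<forall>z \<in> epigraph X f. c < n \<bullet> z"
    using separating_hyperplane_closed_point by blast
  obtain a b where n: "n = (a, b)" by (cases n)
  have above_graph: "c < a \<bullet> x + b * f x" if "x \<in> X" for x
    using above that by (auto simp: n epigraph_def)
  have "b * \<epsilon> > 0"
    using below above_graph[OF assms(4)] by (simp add: n algebra_simps)
  then have b: "b > 0" using assms(5) by (simp add: zero_less_mult_iff)
  show ?thesis
  proof
    show "(- a /\<^sub>R b) \<bullet> x + c / b \<le> f x" if "x \<in> X" for x
      using above_graph[OF that] b by (simp add: field_simps)
    show "f y - \<epsilon> < (- a /\<^sub>R b) \<bullet> y + c / b"
      using below b by (simp add: n field_simps)
  qed
qed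

text \<open>
  The sets on which one minorant exceeds \<open>f - \<epsilon>\<close> form a relatively open cover of \<open>X\<close>, from which
  compactness selects \<open>T\<close>. A maximum over \<open>T\<close> requires \<open>T \<noteq> {}\<close>, which the subcover provides only
  if \<open>X \<noteq> {}\<close>.
\<close>

lemma finitely_many_affine_minorants:
  fixes f :: "'a::euclidean_space \<Rightarrow> real"
  assumes "compact X" "convex_on X f" "continuous_on X f" "\<epsilon> > 0"
  obtains T :: "('a \<times> real) set" where "finite T" "T \<noteq> {}"
    "\<And>x a c. x \<in> X \<Longrightarrow> (a, c) \<in> T \<Longrightarrow> a \<bullet> x + c \<le> f x"
    "\<And>x. x \<in> X \<Longrightarrow> \<exists>(a, c) \<in> T. f x - \<epsilon> < a \<bullet> x + c"
proof -
  define M where "M = {(a, c). \<forall>x\<in>X. a \<bullet> x + c \<le> f x}"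
  define U where "U = (\<lambda>(a, c). {x \<in> X. f x - \<epsilon> < a \<bullet> x + c})"
  have "\<exists>V. open V \<and> U p = X \<inter> V" for p
  proof -
    obtain a c where p: "p = (a, c)" by (cases p)
    have "continuous_on X (\<lambda>x. f x - \<epsilon> - (a \<bullet> x + c))"
      by (intro continuous_intros assms)
    then have "openin (top_of_set X) (X \<inter> (\<lambda>x. f x - \<epsilon> - (a \<bullet> x + c)) -` {..<0})"
      by (intro continuous_openin_preimage_gen) auto
    moreover have "U p = X \<inter> (\<lambda>x. f x - \<epsilon> - (a \<bullet> x + c)) -` {..<0}"
      by (auto simp: U_def p)
    ultimately show ?thesis by (auto simp: openin_open)
  qed
  then obtain V where V: "\<And>p. open (V p)" "\<And>p. U p = X \<inter> V p" by metis
  have "\<exists>p\<in>M. x \<in> U p" if x: "x \<in> X" for x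
  proof -
    obtain a c where "\<And>u. u \<in> X \<Longrightarrow> a \<bullet> u + c \<le> f u" "f x - \<epsilon> < a \<bullet> x + c"
      using affine_minorant_near_point[OF compact_imp_closed[OF assms(1)] assms(2,3) x assms(4)]
      by blast
    then have "(a, c) \<in> M" "x \<in> U (a, c)" using x by (auto simp: M_def U_def)
    then show ?thesis by blast
  qed
  then have "X \<subseteq> (\<Union>p\<in>M. V p)" using V(2) by blast
  then obtain T where T: "T \<subseteq> M" "finite T" "X \<subseteq> (\<Union>p\<in>T. V p)"
    using compactE_image[OF assms(1)] V(1) by metis
  have cover: "\<exists>p\<in>T. x \<in> U p" if "x \<in> X" for x using T(3) V(2) that by blast
  show ?thesis
  proof (cases "X = {}")
    case True
    then show ?thesis using that[of "{(0, 0)}"] by auto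
  next
    case False
    show ?thesis
    proof (rule that[of T])
      show "T \<noteq> {}" using False cover by blast
      show "finite T" by (rule T(2))
      show "a \<bullet> x + c \<le> f x" if "x \<in> X" "(a, c) \<in> T" for x a c
        using T(1) that by (auto simp: M_def)
      show "\<exists>(a, c) \<in> T. f x - \<epsilon> < a \<bullet> x + c" if "x \<in> X" for x
        using cover[OF that] by (auto simp: U_def split: prod.splits)
    qed
  qed
qed

section \<open>Networks for maxima of affine functions\<close>

text \<open>Splitting into positive and negative parts, \<open>t = max t 0 - max (- t) 0\<close>, uses the block \<open>- x\<close> of the
  expanded input to absorb the sign of a coefficient.\<close>

definition split_weights :: "real ^ 'd \<Rightarrow> 'd + 'd \<Rightarrow> real" where
  "split_weights a j = (case j of Inl i \<Rightarrow> max (a $ i) 0 | Inr i \<Rightarrow> max (- (a $ i)) 0)"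

lemma split_weights_nonneg: "0 \<le> split_weights a j"
  by (auto simp: split_weights_def split: sum.split)

lemma sum_split_weights_expand:
  "(\<Sum>j\<in>UNIV. split_weights a j * expand x $ j) = a \<bullet> x"
proof -
  have "(\<Sum>j\<in>UNIV. split_weights a j * expand x $ j)
      = (\<Sum>i\<in>UNIV. max (a $ i) 0 * x $ i) + (\<Sum>i\<in>UNIV. max (- (a $ i)) 0 * - (x $ i))"
    by (simp add: split_weights_def expand_def sum.Plus flip: UNIV_Plus_UNIV)
  also have "\<dots> = (\<Sum>i\<in>UNIV. a $ i * x $ i)"
    unfolding sum.distrib[symmetric] by (rule sum.cong) (auto simp: max_def)
  finally show ?thesis by (simp add: inner_vec_def)
qed

text \<open>A single running value is all that a maximum of a sequence has to remember, so one neuron per layer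
  is enough. The width and all neuron indices are constant for this reason, and \<open>p i \<bullet> x + q i\<close> is the
  affine correction made before the activation of layer \<open>i\<close>.\<close>

definition chain_icnn :: "nat \<Rightarrow> (nat \<Rightarrow> real ^ 'd) \<Rightarrow> (nat \<Rightarrow> real) \<Rightarrow> 'd icnn" where
  "chain_icnn k p q = \<lparr>depth = k, width = (\<lambda>_. 1),
     W_first = (\<lambda>_. split_weights (p 1)), W = (\<lambda>_ _ _. 1),
     D = (\<lambda>i _. split_weights (p i)), bias = (\<lambda>i _. q i)\<rparr>"

text \<open>The recursion also covers the first layer, because the value at layer \<open>0\<close> is \<open>0\<close>.\<close>

lemma layer_chain_icnn:
  "layer (chain_icnn k p q) x (Suc i) r =
     (if Suc i < k then relu else id)
       (layer (chain_icnn k p q) x i 0 + p (Suc i) \<bullet> x + q (Suc i))"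
  by (cases i) (simp_all add: chain_icnn_def activation_def sum_split_weights_expand)

lemma icnn_shape_chain_icnn: "k \<ge> 1 \<Longrightarrow> icnn_shape (chain_icnn k p q)"
  by (simp add: icnn_shape_def chain_icnn_def)

lemma nonneg_weights_chain_icnn: "nonneg_weights (chain_icnn k p q)"
  by (simp add: nonneg_weights_def chain_icnn_def split_weights_nonneg)

text \<open>
  Hidden layer \<open>i\<close> holds the excess of the running maximum over the latest affine function, so that
  it is nonnegative and survives the ReLU. At \<open>i = 0\<close> the running maximum is the first function itself,
  with excess \<open>0\<close>.
\<close>

lemma max_affine_icnn:
  fixes a :: "nat \<Rightarrow> real ^ 'd" and c :: "nat \<Rightarrow> real"
  obtains N :: "'d icnn" where "icnn_shape N" "nonneg_weights N"
    "\<And>x. icnn_output N x = Max ((\<lambda>i. a i \<bullet> x + c i) ` {..n})"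
proof -
  \<comment> \<open>Layer \<open>n + 1\<close> is the output layer: it adds back the last affine function and subtracts nothing.\<close>
  define p where "p = (\<lambda>i. if i \<le> n then a (i - 1) - a i else a (i - 1))"
  define q where "q = (\<lambda>i. if i \<le> n then c (i - 1) - c i else c (i - 1))"
  define N where "N = chain_icnn (Suc n) p q"
  show ?thesis
  proof
    show "icnn_shape N" by (simp add: N_def icnn_shape_chain_icnn)
    show "nonneg_weights N" by (simp add: N_def nonneg_weights_chain_icnn)
    fix x
    define h where "h = (\<lambda>i. a i \<bullet> x + c i)"
    have running_max: "layer N x i 0 + h i = Max (h ` {..i})" if "i \<le> n" for i
      using that
    proof (induction i)
      case 0
      then show ?case by simp
    next
      case (Suc i)
      then have "layer N x (Suc i) 0 = relu (layer N x i 0 + (h i - h (Suc i)))"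
        by (simp add: N_def layer_chain_icnn p_def q_def h_def inner_diff_left algebra_simps)
      also have "\<dots> + h (Suc i) = max (layer N x i 0 + h i) (h (Suc i))"
        by (simp add: relu_def max_def)
      also have "\<dots> = Max (h ` {..Suc i})"
        using Suc by (simp add: atMost_Suc max.commute)
      finally show ?case .
    qed
    have "icnn_output N x = layer N x (Suc n) 0"
      by (simp add: icnn_output_def N_def chain_icnn_def)
    also have "\<dots> = layer N x n 0 + h n"
      by (simp add: N_def layer_chain_icnn p_def q_def h_def)
    finally show "icnn_output N x = Max ((\<lambda>i. a i \<bullet> x + c i) ` {..n})"
      by (simp add: running_max) (simp add: h_def)
  qed
qed

section \<open>Approximation of convex functions\<close>

theorem theorem1:
  fixes X :: "(real ^ 'd) set" and f :: "real ^ 'd \<Rightarrow> real" and \<epsilon> :: real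
  assumes "compact X" and "convex X"
    and "\<exists>L. L-lipschitz_on X f" and "convex_on X f"
    and "\<epsilon> > 0"
  shows "\<exists>N :: 'd icnn. icnn_shape N \<and> nonneg_weights N \<and>
           (\<forall>x\<in>X. \<bar>f x - icnn_output N x\<bar> \<le> \<epsilon>)"
proof -
  have "continuous_on X f"
    using assms(3) lipschitz_on_continuous_on by blast
  then obtain T where T: "finite T" "T \<noteq> {}"
    and below: "\<And>x a c. x \<in> X \<Longrightarrow> (a, c) \<in> T \<Longrightarrow> a \<bullet> x + c \<le> f x"
    and near: "\<And>x. x \<in> X \<Longrightarrow> \<exists>(a, c) \<in> T. f x - \<epsilon> < a \<bullet> x + c"
    using finitely_many_affine_minorants assms by metis
  obtain ts where ts: "set ts = T" using finite_list[OF T(1)] by blast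
  define n where "n = length ts - 1"
  have "length ts = Suc n" using ts T(2) by (cases ts) (auto simp: n_def)
  then have T_eq: "T = (!) ts ` {..n}"
    by (auto simp: ts[symmetric] set_conv_nth less_Suc_eq_le)
  obtain N :: "'d icnn" where N: "icnn_shape N" "nonneg_weights N"
    "\<And>x. icnn_output N x = Max ((\<lambda>i. fst (ts ! i) \<bullet> x + snd (ts ! i)) ` {..n})"
    using max_affine_icnn[of "\<lambda>i. fst (ts ! i)" "\<lambda>i. snd (ts ! i)" n] by blast
  have out: "icnn_output N x = Max ((\<lambda>(a, c). a \<bullet> x + c) ` T)" for x
    by (simp add: N(3) T_eq image_image case_prod_beta)
  have "\<bar>f x - icnn_output N x\<bar> \<le> \<epsilon>" if x: "x \<in> X" for x
  proof -
    have "icnn_output N x \<le> f x"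
      unfolding out using T below[OF x] by (subst Max_le_iff) auto
    moreover obtain a c where ac: "(a, c) \<in> T" "f x - \<epsilon> < a \<bullet> x + c"
      using near[OF x] by blast
    then have "a \<bullet> x + c \<le> icnn_output N x"
      unfolding out using T(1) by (intro Max_ge) force+
    ultimately show ?thesis using ac(2) \<open>\<epsilon> > 0\<close> by linarith
  qed
  then show ?thesis using N by blast
qed

end
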